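(* Let $A^\ast_{n,\le m}$, $\xi_n$, $\alpha_j$ be taken from any one of the four families (Bernoulli, Cauchy, Euler, Euler of the second kind) described in the context, with the corresponding integer parameter $N$. For positive integers $n$ and $m$, we have $$A_{n,\le m}^\ast=\xi_n\sum_{k=1}^n(-1)^{n-k}\sum_{\substack{i_1+\cdots+i_k=n\\ 1\le i_1,\dots,i_k\le m}}\alpha_{i_1}\cdots\alpha_{i_k}.$$
   Context: $(x)^{(n)}=x(x+1)\cdots(x+n-1)$ for $n\ge1$ and $(x)^{(0)}=1$ (rising factorial). All identities below are between formal power series in $x$. For an integer $m\ge 1$ define the modified restricted hypergeometric numbers by: - Bernoulli ($N\ge1$): $\left(\sum_{n=0}^{m}\frac{x^n}{(N+1)^{(n)}}\right)^{-1}=\sum_{n=0}^\infty B_{N,n,\le m}^\ast\frac{x^n}{n!}$; - Cauchy ($N\ge1$): $\left(N\sum_{n=0}^{m}\frac{(-x)^n}{N+n}\right)^{-1}=\sum_{n=0}^\infty c_{N,n,\le m}^\ast\frac{x^n}{n!}$; - Euler ($N\ge0$): $\left(\sum_{n=0}^{m}\frac{x^{2n}}{(2N+1)^{(2n)}}\right)^{-1}=\sum_{n=0}^\infty E_{N,n,\le m}^\ast\frac{x^n}{n!}$; - Euler of the second kind ($N\ge0$): $\left(\sum_{n=0}^{m}\frac{x^{2n}}{(2N+2)^{(2n)}}\right)^{-1}=\sum_{n=0}^\infty\widehat E_{N,n,\le m}^\ast\frac{x^n}{n!}$. The symbols $A^\ast_{n,\le m}$, $\xi_n$ ($n\ge0$),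 $\alpha_j$ ($j\ge1$) denote simultaneously one of the following choices ($N$ is suppressed from the notation): - Bernoulli: $A^\ast_{n,\le m}=B^\ast_{N,n,\le m}$, $\xi_n=(-1)^n n!$, $\alpha_j=\frac{N!}{(N+j)!}$, $N\ge1$; - Cauchy: $A^\ast_{n,\le m}=c^\ast_{N,n,\le m}$, $\xi_n=n!$, $\alpha_j=\frac{N}{N+j}$, $N\ge1$; - Euler: $A^\ast_{n,\le m}=E^\ast_{N,2n,\le m}$, $\xi_n=(-1)^n(2n)!$, $\alpha_j=\frac{(2N)!}{(2N+2j)!}$, $N\ge0$; - Euler of the second kind: $A^\ast_{n,\le m}=\widehat E^\ast_{N,2n,\le m}$, $\xi_n=(-1)^n(2n)!$, $\alpha_j=\frac{(2N+1)!}{(2N+2j+1)!}$, $N\ge0$. Inner sums run over ordered $k$-tuples of integers. *)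

theory Defs
  imports "HOL-Computational_Algebra.Formal_Power_Series"
begin

(* pochhammer is the rising factorial.  All series have a nonzero constant
   term (for Cauchy because N >= 1), so fps inverse is their true multiplicative inverse;
   see the generating function lemmas below. *)

definition bernoulli_series :: "nat \<Rightarrow> nat \<Rightarrow> rat fps" where
  "bernoulli_series N m =
     (\<Sum>n=0..m. fps_const (1 / pochhammer (of_nat N + 1) n) * fps_X ^ n)"

definition cauchy_series :: "nat \<Rightarrow> nat \<Rightarrow> rat fps" where
  "cauchy_series N m =
     fps_const (of_nat N) * (\<Sum>n=0..m. fps_const (1 / (of_nat N + of_nat n)) * (- fps_X) ^ n)"

definition euler_series :: "nat \<Rightarrow> nat \<Rightarrow> rat fps" where
  "euler_series N m =
     (\<Sum>n=0..m. fps_const (1 / pochhammer (2 * of_nat N + 1) (2 * n)) * fps_X ^ (2 * n))"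

definition euler2_series :: "nat \<Rightarrow> nat \<Rightarrow> rat fps" where
  "euler2_series N m =
     (\<Sum>n=0..m. fps_const (1 / pochhammer (2 * of_nat N + 2) (2 * n)) * fps_X ^ (2 * n))"

(* The arguments of the four number sequences are, in this order, N, n and the bound m. *)

definition bernoulli_num :: "nat \<Rightarrow> nat \<Rightarrow> nat \<Rightarrow> rat" where
  "bernoulli_num N n m = fact n * fps_nth (inverse (bernoulli_series N m)) n"

definition cauchy_num :: "nat \<Rightarrow> nat \<Rightarrow> nat \<Rightarrow> rat" where
  "cauchy_num N n m = fact n * fps_nth (inverse (cauchy_series N m)) n"

definition euler_num :: "nat \<Rightarrow> nat \<Rightarrow> nat \<Rightarrow> rat" where
  "euler_num N n m = fact n * fps_nth (inverse (euler_series N m)) n"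

definition euler2_num :: "nat \<Rightarrow> nat \<Rightarrow> nat \<Rightarrow> rat" where
  "euler2_num N n m = fact n * fps_nth (inverse (euler2_series N m)) n"

lemma bernoulli_num_gf:
  "bernoulli_series N m * Abs_fps (\<lambda>n. bernoulli_num N n m / fact n) = 1"
proof -
  have "Abs_fps (\<lambda>n. bernoulli_num N n m / fact n) = inverse (bernoulli_series N m)"
    by (simp add: fps_eq_iff bernoulli_num_def)
  moreover have "fps_nth (bernoulli_series N m) 0 = 1"
    by (simp add: bernoulli_series_def fps_sum_nth sum.atLeast_Suc_atMost)
  ultimately show ?thesis by (simp add: inverse_mult_eq_1')
qed

lemma cauchy_num_gf:
  assumes "N \<ge> 1"
  shows "cauchy_series N m * Abs_fps (\<lambda>n. cauchy_num N n m / fact n) = 1"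
proof -
  have "Abs_fps (\<lambda>n. cauchy_num N n m / fact n) = inverse (cauchy_series N m)"
    by (simp add: fps_eq_iff cauchy_num_def)
  moreover have "fps_nth (cauchy_series N m) 0 = 1"
    using assms
    by (simp add: cauchy_series_def fps_sum_nth sum.atLeast_Suc_atMost fps_nth_power_0 power_0_left)
  ultimately show ?thesis by (simp add: inverse_mult_eq_1')
qed

lemma euler_num_gf:
  "euler_series N m * Abs_fps (\<lambda>n. euler_num N n m / fact n) = 1"
proof -
  have "Abs_fps (\<lambda>n. euler_num N n m / fact n) = inverse (euler_series N m)"
    by (simp add: fps_eq_iff euler_num_def)
  moreover have "fps_nth (euler_series N m) 0 = 1"
    by (simp add: euler_series_def fps_sum_nth sum.atLeast_Suc_atMost)
  ultimately show ?thesis by (simp add: inverse_mult_eq_1')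
qed

lemma euler2_num_gf:
  "euler2_series N m * Abs_fps (\<lambda>n. euler2_num N n m / fact n) = 1"
proof -
  have "Abs_fps (\<lambda>n. euler2_num N n m / fact n) = inverse (euler2_series N m)"
    by (simp add: fps_eq_iff euler2_num_def)
  moreover have "fps_nth (euler2_series N m) 0 = 1"
    by (simp add: euler2_series_def fps_sum_nth sum.atLeast_Suc_atMost)
  ultimately show ?thesis by (simp add: inverse_mult_eq_1')
qed

datatype family = Bernoulli | Cauchy | Euler | Euler2

primrec min_param :: "family \<Rightarrow> nat" where
  "min_param Bernoulli = 1"
| "min_param Cauchy = 1"
| "min_param Euler = 0"
| "min_param Euler2 = 0"

(* The two Euler generating functions are even, so only the numbers of even index matter. *)
primrec A_num :: "family \<Rightarrow> nat \<Rightarrow> nat \<Rightarrow> nat \<Rightarrow> rat" where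
  "A_num Bernoulli N n m = bernoulli_num N n m"
| "A_num Cauchy N n m = cauchy_num N n m"
| "A_num Euler N n m = euler_num N (2 * n) m"
| "A_num Euler2 N n m = euler2_num N (2 * n) m"

primrec xi :: "family \<Rightarrow> nat \<Rightarrow> rat" where
  "xi Bernoulli n = (- 1) ^ n * fact n"
| "xi Cauchy n = fact n"
| "xi Euler n = (- 1) ^ n * fact (2 * n)"
| "xi Euler2 n = (- 1) ^ n * fact (2 * n)"

primrec alpha :: "family \<Rightarrow> nat \<Rightarrow> nat \<Rightarrow> rat" where
  "alpha Bernoulli N j = fact N / fact (N + j)"
| "alpha Cauchy N j = of_nat N / of_nat (N + j)"
| "alpha Euler N j = fact (2 * N) / fact (2 * N + 2 * j)"
| "alpha Euler2 N j = fact (2 * N + 1) / fact (2 * N + 2 * j + 1)"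

(* Ordered k-tuples are lists of length k. *)
definition bounded_compositions :: "nat \<Rightarrow> nat \<Rightarrow> nat \<Rightarrow> nat list set" where
  "bounded_compositions n k m =
     {is. length is = k \<and> sum_list is = n \<and> (\<forall>i\<in>set is. 1 \<le> i \<and> i \<le> m)}"

lemma finite_bounded_compositions: "finite (bounded_compositions n k m)"
  by (rule finite_subset[OF _ finite_lists_length_eq[of "{..m}" k]])
    (auto simp: bounded_compositions_def)

end

theory Submission
  imports Defs
begin

text \<open>
  All four families come from one polynomial
  \<open>h(x) = 1 + \<alpha>\<^sub>1 x + \<dots> + \<alpha>\<^sub>m x\<^sup>m\<close>: the series that is inverted is \<open>h(x)\<close>
  for the Bernoulli numbers, \<open>h(-x)\<close> for the Cauchy numbers and \<open>h(x\<^sup>2)\<close> for both kinds of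
  Euler numbers, because \<open>(M + 1)\<^sup>(\<^sup>j\<^sup>) = (M + j)! / M!\<close>.  A substitution of a series without
  constant term commutes with inversion, so each family reads off the coefficient of \<open>x\<^sup>n\<close> in
  \<open>1/h(x)\<close>, up to the factorial and, for Cauchy, a sign \<open>(-1)\<^sup>n\<close>.

  Since \<open>h\<close> has constant term 1, the geometric series gives \<open>1/h = (\<Sum>k. (1 - h)\<^sup>k)\<close>.
  Only the powers \<open>k \<le> n\<close> reach the coefficient of \<open>x\<^sup>n\<close>, and expanding the \<open>k\<close>-th power
  of \<open>1 - h = -(\<alpha>\<^sub>1 x + \<dots> + \<alpha>\<^sub>m x\<^sup>m)\<close> gives \<open>(-1)\<^sup>k\<close> times the sum over the
  compositions of \<open>n\<close> into \<open>k\<close> parts of size at most \<open>m\<close>.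
  The sign \<open>(-1)\<^sup>k\<close> is \<open>(-1)\<^sup>n (-1)\<^sup>n\<^sup>-\<^sup>k\<close>, which explains the factor
  \<open>(-1)\<^sup>n\<close> in \<open>\<xi>\<^sub>n\<close> for the three families other than Cauchy.
\<close>

section \<open>Inverting a polynomial with constant term 1\<close>

lemma fps_nth_inverse_geometric:
  fixes f :: "'a::field fps"
  assumes "fps_nth f 0 = 1"
  shows "fps_nth (inverse f) n = (\<Sum>k\<le>n. fps_nth ((1 - f) ^ k) n)"
proof -
  have "f * (\<Sum>k\<le>n. (1 - f) ^ k) = 1 - (1 - f) ^ Suc n"
    using sum_gp_basic[of "1 - f" n] by simp
  then have "inverse f * f * (\<Sum>k\<le>n. (1 - f) ^ k) = inverse f - inverse f * (1 - f) ^ Suc n"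
    by (simp add: mult.assoc right_diff_distrib)
  then have geo: "inverse f = (\<Sum>k\<le>n. (1 - f) ^ k) + inverse f * (1 - f) ^ Suc n"
    using assms by (simp add: inverse_mult_eq_1)
  \<comment> \<open>The remainder has order at least \<open>n + 1\<close>.\<close>
  have "fps_nth ((1 - f) ^ Suc n) i = 0" if "i \<le> n" for i
    using startsby_zero_power_prefix[of "1 - f" "Suc n"] that assms by simp
  then have "fps_nth (inverse f * (1 - f) ^ Suc n) n = 0"
    by (simp add: fps_mult_nth del: power_Suc)
  then show ?thesis
    by (subst geo) (simp add: fps_sum_nth del: power_Suc)
qed

definition truncation :: "(nat \<Rightarrow> 'a::comm_ring_1) \<Rightarrow> nat \<Rightarrow> 'a fps" where
  "truncation a m = (\<Sum>j=0..m. fps_const (a j) * fps_X ^ j)"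

lemma fps_nth_truncation: "fps_nth (truncation a m) j = (if j \<le> m then a j else 0)"
proof -
  have "fps_nth (truncation a m) j = (\<Sum>i=0..m. if i = j then a i else 0)"
    unfolding truncation_def fps_sum_nth
    by (intro sum.cong) auto
  then show ?thesis by simp
qed

text \<open>
  A power of a series is a sum over all lists of exponents; those with a part equal to 0 or larger
  than \<open>m\<close> contribute 0, which leaves the bounded compositions.
\<close>

lemma fps_nth_power_one_minus_truncation:
  fixes a :: "nat \<Rightarrow> 'a::comm_ring_1"
  assumes "a 0 = 1"
  shows "fps_nth ((1 - truncation a m) ^ k) n =
    (- 1) ^ k * (\<Sum>is\<in>bounded_compositions n k m. \<Prod>i\<leftarrow>is. a i)"
proof -
  define g where "g = 1 - truncation a m"
  have g_nth: "fps_nth g i = (if 1 \<le> i \<and> i \<le> m then - a i else 0)" for i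
    using assms by (cases i) (simp_all add: g_def fps_nth_truncation)
  have "fps_nth (g ^ k) n = (\<Sum>is\<in>natpermute n k. \<Prod>i\<leftarrow>is. fps_nth g i)"
  proof (cases k)
    case 0
    have "natpermute n 0 = (if n = 0 then {[]} else {})"
      by (auto simp: natpermute_def)
    with 0 show ?thesis by simp
  next
    case (Suc l)
    show ?thesis
      unfolding Suc fps_power_nth_Suc
      by (intro sum.cong)
        (auto simp: natpermute_def prod.list_conv_set_nth atLeastLessThanSuc_atLeastAtMost
          simp del: prod.op_ivl_Suc)
  qed
  also have "\<dots> = (\<Sum>is\<in>bounded_compositions n k m. \<Prod>i\<leftarrow>is. fps_nth g i)"
  proof (rule sum.mono_neutral_right)
    show "finite (natpermute n k)" by (rule natpermute_finite)
    show "bounded_compositions n k m \<subseteq> natpermute n k"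
      by (auto simp: bounded_compositions_def natpermute_def)
    show "\<forall>is\<in>natpermute n k - bounded_compositions n k m. (\<Prod>i\<leftarrow>is. fps_nth g i) = 0"
    proof
      fix v assume "v \<in> natpermute n k - bounded_compositions n k m"
      then obtain i where "i \<in> set v" "\<not> (1 \<le> i \<and> i \<le> m)"
        by (auto simp: bounded_compositions_def natpermute_def)
      then have "i \<in> set v" "fps_nth g i = 0"
        by (auto simp: g_nth)
      then show "(\<Prod>i\<leftarrow>v. fps_nth g i) = 0"
        by (induction v) auto
    qed
  qed
  also have "\<dots> = (\<Sum>is\<in>bounded_compositions n k m. (- 1) ^ k * (\<Prod>i\<leftarrow>is. a i))"
  proof (rule sum.cong[OF refl])
    have "(\<Prod>i\<leftarrow>is. fps_nth g i) = (- 1) ^ length is * (\<Prod>i\<leftarrow>is. a i)"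
      if "\<forall>i\<in>set is. 1 \<le> i \<and> i \<le> m" for "is"
      using that by (induction "is") (simp_all add: g_nth)
    then show "(\<Prod>i\<leftarrow>is. fps_nth g i) = (- 1) ^ k * (\<Prod>i\<leftarrow>is. a i)"
      if "is \<in> bounded_compositions n k m" for "is"
      using that by (auto simp: bounded_compositions_def)
  qed
  finally show ?thesis
    by (simp add: g_def sum_distrib_left)
qed

lemma fps_nth_inverse_truncation:
  fixes a :: "nat \<Rightarrow> 'a::field"
  assumes "a 0 = 1" and "n \<ge> 1"
  shows "fps_nth (inverse (truncation a m)) n =
    (- 1) ^ n * (\<Sum>k=1..n. (- 1) ^ (n - k) *
      (\<Sum>is\<in>bounded_compositions n k m. \<Prod>i\<leftarrow>is. a i))"
proof -
  let ?S = "\<lambda>k. \<Sum>is\<in>bounded_compositions n k m. \<Prod>i\<leftarrow>is. a i"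
  have "fps_nth (inverse (truncation a m)) n = (\<Sum>k\<le>n. (- 1) ^ k * ?S k)"
    using assms(1)
    by (simp add: fps_nth_inverse_geometric fps_nth_truncation fps_nth_power_one_minus_truncation)
  also have "\<dots> = (\<Sum>k=1..n. (- 1) ^ k * ?S k)"
  proof (rule sum.mono_neutral_right)
    \<comment> \<open>A positive \<open>n\<close> has no composition into zero parts.\<close>
    have "bounded_compositions n 0 m = {}"
      using assms(2) by (auto simp: bounded_compositions_def)
    then show "\<forall>k\<in>{..n} - {1..n}. (- 1) ^ k * ?S k = 0"
      by (auto simp: not_le)
  qed auto
  also have "\<dots> = (\<Sum>k=1..n. (- 1) ^ n * ((- 1) ^ (n - k) * ?S k))"
  proof (rule sum.cong[OF refl])
    fix k assume "k \<in> {1..n}"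
    then have "n + (n - k) = k + 2 * (n - k)" by auto
    then have "(- 1 :: 'a) ^ n * (- 1) ^ (n - k) = (- 1) ^ k"
      by (metis mult.right_neutral power_add power_mult power_minus1_even)
    then show "(- 1) ^ k * ?S k = (- 1) ^ n * ((- 1) ^ (n - k) * ?S k)"
      by (simp flip: mult.assoc)
  qed
  finally show ?thesis by (simp add: sum_distrib_left)
qed

section \<open>Substituting into the polynomial\<close>

lemma truncation_compose:
  fixes u :: "'a::idom fps"
  assumes "fps_nth u 0 = 0"
  shows "truncation a m oo u = (\<Sum>j=0..m. fps_const (a j) * u ^ j)"
  using assms
  by (simp add: truncation_def fps_compose_sum_distrib fps_compose_mult_distrib
      fps_X_power_compose)

lemma inverse_truncation_compose:
  fixes u :: "'a::field fps"
  assumes "fps_nth u 0 = 0" and "a 0 = 1"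
  shows "inverse (\<Sum>j=0..m. fps_const (a j) * u ^ j) = inverse (truncation a m) oo u"
  using assms by (simp add: fps_inverse_compose fps_nth_truncation flip: truncation_compose)

lemma fps_nth_compose_X_squared:
  fixes f :: "'a::comm_ring_1 fps"
  shows "fps_nth (f oo fps_X ^ 2) (2 * n) = fps_nth f n"
proof -
  have "fps_nth (f oo fps_X ^ 2) (2 * n) = (\<Sum>i=0..2 * n. if i = n then fps_nth f i else 0)"
    unfolding fps_compose_nth
    by (intro sum.cong) (auto simp flip: power_mult)
  then show ?thesis by simp
qed

section \<open>The four families\<close>

lemma inverse_pochhammer_of_nat_Suc:
  "1 / pochhammer (of_nat M + 1 :: 'a::field_char_0) j = fact M / fact (M + j)"
proof -
  have "fact (M + j) = (fact M * pochhammer (of_nat M + 1) j :: 'a)"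
    by (simp add: pochhammer_fact pochhammer_product' add.commute)
  then show ?thesis by simp
qed

lemma alpha_0: "N \<ge> min_param F \<Longrightarrow> alpha F N 0 = 1"
  by (cases F) auto

lemma bernoulli_series_eq: "bernoulli_series N m = truncation (alpha Bernoulli N) m"
  by (simp add: bernoulli_series_def truncation_def inverse_pochhammer_of_nat_Suc)

lemma cauchy_series_eq:
  "cauchy_series N m = (\<Sum>j=0..m. fps_const (alpha Cauchy N j) * (- fps_X) ^ j)"
  by (simp add: cauchy_series_def sum_distrib_left flip: mult.assoc)

lemma euler_series_eq:
  "euler_series N m = (\<Sum>j=0..m. fps_const (alpha Euler N j) * (fps_X ^ 2) ^ j)"
  using inverse_pochhammer_of_nat_Suc[of "2 * N", where 'a = rat]
  by (simp add: euler_series_def power_mult)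

lemma euler2_series_eq:
  "euler2_series N m = (\<Sum>j=0..m. fps_const (alpha Euler2 N j) * (fps_X ^ 2) ^ j)"
  using inverse_pochhammer_of_nat_Suc[of "2 * N + 1", where 'a = rat]
  by (simp add: euler2_series_def power_mult add.commute)

text \<open>
  The factor \<open>(-1)\<^sup>n\<close> cancels the sign in \<open>\<xi>\<^sub>n\<close>; for the Cauchy numbers, whose
  \<open>\<xi>\<^sub>n\<close> has no sign, it comes from the substitution of \<open>-x\<close>.
\<close>

lemma A_num_eq_xi_times_nth_inverse:
  assumes "N \<ge> min_param F"
  shows "A_num F N n m = xi F n * ((- 1) ^ n * fps_nth (inverse (truncation (alpha F N) m)) n)"
proof (cases F)
  case Bernoulli
  then show ?thesis by (simp add: bernoulli_num_def bernoulli_series_eq)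
next
  case Cauchy
  have "inverse (cauchy_series N m) = inverse (truncation (alpha Cauchy N) m) oo (- fps_X)"
    unfolding cauchy_series_eq
    using alpha_0[OF assms] Cauchy by (intro inverse_truncation_compose) simp_all
  with Cauchy show ?thesis
    by (simp add: cauchy_num_def fps_compose_uminus')
next
  case Euler
  have "inverse (euler_series N m) = inverse (truncation (alpha Euler N) m) oo fps_X ^ 2"
    unfolding euler_series_eq
    using alpha_0[OF assms] Euler by (intro inverse_truncation_compose) simp_all
  with Euler show ?thesis
    by (simp add: euler_num_def fps_nth_compose_X_squared)
next
  case Euler2
  have "inverse (euler2_series N m) = inverse (truncation (alpha Euler2 N) m) oo fps_X ^ 2"
    unfolding euler2_series_eq
    using alpha_0[OF assms] Euler2 by (intro inverse_truncation_compose) simp_all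
  with Euler2 show ?thesis
    by (simp add: euler2_num_def fps_nth_compose_X_squared)
qed

theorem proposition4:
  fixes F :: family and N n m :: nat
  assumes "N \<ge> min_param F" and "n \<ge> 1" and "m \<ge> 1"
  shows "A_num F N n m =
    xi F n * (\<Sum>k=1..n. (- 1) ^ (n - k) *
      (\<Sum>is\<in>bounded_compositions n k m. \<Prod>i\<leftarrow>is. alpha F N i))"
  using fps_nth_inverse_truncation[of "alpha F N" n m, OF alpha_0[OF assms(1)] assms(2)]
  by (simp add: A_num_eq_xi_times_nth_inverse[OF assms(1)] flip: mult.assoc)

end
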